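(* Let $G$ be a connected graph, $\mu$ a metric on $G$, and $\alpha\in H_1(G,\mathbb{Z})$ nonzero. Let $H=\mathrm{supp}(\alpha)$ with connected components $H_1,\dots,H_s$, let $G|_H$ be the graph obtained from $G$ by contracting each $H_i$ to a single vertex $w_i$ (every edge of $G$ not in $H$ is kept, with endpoints replaced by their images, and keeps its $\mu$-weight), and let $\mu(T_\alpha)$ denote the minimum of $\sum_{e\in E(T)}\mu(e)$ over all subtrees $T$ of $G|_H$ whose vertex set contains $\{w_1,\dots,w_s\}$ (so $\mu(T_\alpha)=0$ when $s=1$). Then $\mathcal{C}_G(\alpha)$ is nonempty and the minimum $\mu$-length of a circuit in $\mathcal{C}_G(\alpha)$ equals $2\mu(T_\alpha)+\Vert\alpha\Vert_\mu$.
   Context: A graph is finite, may have loops and multiple edges, and has no isolated vertices. Each edge $e$ gives two oriented edges $\mathbf{e},\mathbf{e}^{-1}$ with initial/terminal vertices $\mathbf{e}(0),\mathbf{e}(1)$; $\mathbf{E}(G)$ is the set of oriented edges. An orientation $\mathfrak{o}$ chooses one oriented edge per edge, giving $\mathbf{E}_{\mathfrak{o}}(G)$. A walk is a sequence $\mathbf{a}_1\cdots\mathbf{a}_l$ of oriented edges with $\mathbf{a}_{i+1}(0)=\mathbf{a}_i(1)$; a circuit is a closed walk ($\mathbf{a}_l(1)=\mathbf{a}_1(0)$) with no backtrack ($\mathbf{a}_{i+1}\ne\mathbf{a}_i^{-1}$) and no tail ($\mathbf{a}_1\ne\mathbf{a}_l^{-1}$). $C_1(G,\mathbb{Z})$ is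 the free abelian group on $\mathbf{E}_{\mathfrak{o}}(G)$ with $\mathbf{e}^{-1}=-\mathbf{e}$. For $\alpha=\sum_{\mathbf{e}\in\mathbf{E}_{\mathfrak{o}}(G)}c_{\mathbf{e}}\mathbf{e}$: $\deg_\alpha(\mathbf{e})=c_{\mathbf{e}}$, $\deg_\alpha(\mathbf{e}^{-1})=-c_{\mathbf{e}}$, $\deg_\alpha(v)=\sum_{\mathbf{e}\in\mathbf{E}(G),\mathbf{e}(0)=v}\deg_\alpha(\mathbf{e})$; $H_1(G,\mathbb{Z})=\{\alpha:\deg_\alpha(v)=0\ \forall v\}$. The abelianization of a walk is the sum of its oriented edges in $C_1(G,\mathbb{Z})$; $\mathcal{C}_G(\alpha)$ is the set of circuits with abelianization $\alpha$. A metric is $\mu:E(G)\to\mathbb{R}_{>0}$, extended by $\mu(\mathbf{e})=\mu(\mathbf{e}^{-1})=\mu(e)$; the $\mu$-length of a walk is $\sum_i\mu(\mathbf{a}_i)$; $\Vert\alpha\Vert_\mu=\sum_{\mathbf{e}\in\mathbf{E}_{\mathfrak{o}}(G)}|c_{\mathbf{e}}|\mu(\mathbf{e})$. For nonzero $\alpha$, writing it uniquely as $\sum c_{\mathbf{e}}\mathbf{e}$ with all $c_{\mathbf{e}}>0$ over oriented edges with distinct underlying edges, $\mathrm{supp}(\alpha)$ is the subgraph formed by these underlying edges and their endpoints. *)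

theory Defs
  imports Complex_Main "HOL-Library.Poly_Mapping" "Graph_Theory.Digraph_Component"
begin

text \<open>
  An undirected graph, possibly with loops and multiple edges, is given together with an
  orientation as a digraph: the arcs of the digraph are the edges of the graph, and the tail
  and head of an arc are the initial and terminal vertex of the oriented edge which the
  orientation selects. An oriented edge is a pair \<open>(e, b)\<close>, where \<open>b\<close> tells
  whether \<open>e\<close> is taken in its selected direction; so a loop, too, has two distinct
  oriented edges. Connectedness is \<open>Digraph_Component.connected\<close>, which ignores the
  direction of arcs. The notions \<open>tree\<close>, \<open>forest\<close> and \<open>awalk\<close> of that library
  are sensitive to the direction and are not used.
\<close>

definition finite_graph :: "('a, 'b) pre_digraph \<Rightarrow> bool" where
  "finite_graph G \<longleftrightarrow> fin_digraph G \<and>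
     (\<forall>v \<in> verts G. \<exists>e \<in> arcs G. tail G e = v \<or> head G e = v)"

definition oriented_edges :: "('a, 'b) pre_digraph \<Rightarrow> ('b \<times> bool) set" where
  "oriented_edges G = arcs G \<times> UNIV"

fun initial :: "('a, 'b) pre_digraph \<Rightarrow> 'b \<times> bool \<Rightarrow> 'a" where
  "initial G (e, b) = (if b then tail G e else head G e)"

fun terminal :: "('a, 'b) pre_digraph \<Rightarrow> 'b \<times> bool \<Rightarrow> 'a" where
  "terminal G (e, b) = (if b then head G e else tail G e)"

fun inv_edge :: "'b \<times> bool \<Rightarrow> 'b \<times> bool" where
  "inv_edge (e, b) = (e, \<not> b)"

definition walk :: "('a, 'b) pre_digraph \<Rightarrow> ('b \<times> bool) list \<Rightarrow> bool" where
  "walk G p \<longleftrightarrow> p \<noteq> [] \<and> set p \<subseteq> oriented_edges G \<and>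
     successively (\<lambda>a a'. initial G a' = terminal G a) p"

definition closed_walk :: "('a, 'b) pre_digraph \<Rightarrow> ('b \<times> bool) list \<Rightarrow> bool" where
  "closed_walk G p \<longleftrightarrow> walk G p \<and> terminal G (last p) = initial G (hd p)"

definition has_backtrack :: "('b \<times> bool) list \<Rightarrow> bool" where
  "has_backtrack p \<longleftrightarrow> \<not> successively (\<lambda>a a'. a' \<noteq> inv_edge a) p"

definition has_tail :: "('b \<times> bool) list \<Rightarrow> bool" where
  "has_tail p \<longleftrightarrow> hd p = inv_edge (last p)"

definition circuit :: "('a, 'b) pre_digraph \<Rightarrow> ('b \<times> bool) list \<Rightarrow> bool" where
  "circuit G p \<longleftrightarrow> closed_walk G p \<and> \<not> has_backtrack p \<and> \<not> has_tail p"

text \<open>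
  Integral chains are elements of the free abelian group on the selected oriented edges, which
  is rendered by finitely supported functions (as in the theory on free abelian groups of
  \<open>HOL-Algebra\<close>).
\<close>

definition C1 :: "('a, 'b) pre_digraph \<Rightarrow> ('b \<Rightarrow>\<^sub>0 int) set" where
  "C1 G = {\<alpha>. Poly_Mapping.keys \<alpha> \<subseteq> arcs G}"

fun deg_edge :: "('b \<Rightarrow>\<^sub>0 int) \<Rightarrow> 'b \<times> bool \<Rightarrow> int" where
  "deg_edge \<alpha> (e, b) = (if b then Poly_Mapping.lookup \<alpha> e else - Poly_Mapping.lookup \<alpha> e)"

definition deg_vertex :: "('a, 'b) pre_digraph \<Rightarrow> ('b \<Rightarrow>\<^sub>0 int) \<Rightarrow> 'a \<Rightarrow> int" where
  "deg_vertex G \<alpha> v = (\<Sum>a \<in> {a \<in> oriented_edges G. initial G a = v}. deg_edge \<alpha> a)"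

definition H1 :: "('a, 'b) pre_digraph \<Rightarrow> ('b \<Rightarrow>\<^sub>0 int) set" where
  "H1 G = {\<alpha> \<in> C1 G. \<forall>v \<in> verts G. deg_vertex G \<alpha> v = 0}"

fun edge_chain :: "'b \<times> bool \<Rightarrow> 'b \<Rightarrow>\<^sub>0 int" where
  "edge_chain (e, b) = (if b then frag_of e else - frag_of e)"

definition abelianization :: "('b \<times> bool) list \<Rightarrow> 'b \<Rightarrow>\<^sub>0 int" where
  "abelianization p = sum_list (map edge_chain p)"

definition circuits_of :: "('a, 'b) pre_digraph \<Rightarrow> ('b \<Rightarrow>\<^sub>0 int) \<Rightarrow> ('b \<times> bool) list set" where
  "circuits_of G \<alpha> = {p. circuit G p \<and> abelianization p = \<alpha>}"

definition graph_metric :: "('a, 'b) pre_digraph \<Rightarrow> ('b \<Rightarrow> real) \<Rightarrow> bool" where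
  "graph_metric G \<mu> \<longleftrightarrow> (\<forall>e \<in> arcs G. 0 < \<mu> e)"

definition walk_length :: "('b \<Rightarrow> real) \<Rightarrow> ('b \<times> bool) list \<Rightarrow> real" where
  "walk_length \<mu> p = sum_list (map (\<lambda>a. \<mu> (fst a)) p)"

definition chain_norm :: "('a, 'b) pre_digraph \<Rightarrow> ('b \<Rightarrow> real) \<Rightarrow> ('b \<Rightarrow>\<^sub>0 int) \<Rightarrow> real" where
  "chain_norm G \<mu> \<alpha> = (\<Sum>e \<in> arcs G. \<bar>real_of_int (Poly_Mapping.lookup \<alpha> e)\<bar> * \<mu> e)"

text \<open>
  Reversing the edges with negative coefficient does not change the underlying edges, so the
  edges of the support are those with nonzero coefficient.
\<close>

definition chain_supp :: "('a, 'b) pre_digraph \<Rightarrow> ('b \<Rightarrow>\<^sub>0 int) \<Rightarrow> ('a, 'b) pre_digraph" where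
  "chain_supp G \<alpha> =
     \<lparr> verts = tail G ` Poly_Mapping.keys \<alpha> \<union> head G ` Poly_Mapping.keys \<alpha>,
       arcs = Poly_Mapping.keys \<alpha>, tail = tail G, head = head G \<rparr>"

definition components :: "('a, 'b) pre_digraph \<Rightarrow> ('a, 'b) pre_digraph set" where
  "components H = {K. pre_digraph.max_subgraph H Digraph_Component.connected K}"

text \<open>
  The vertices of the contracted graph are the fibres of the contraction map: the vertex to
  which a component \<open>K\<close> is contracted is \<open>verts K\<close>, and a vertex \<open>v\<close> outside all
  components (for which the union below is empty) becomes \<open>{v}\<close>.
\<close>

definition contraction_map :: "('a, 'b) pre_digraph \<Rightarrow> 'a \<Rightarrow> 'a set" where
  "contraction_map H v = insert v (\<Union>K \<in> {K \<in> components H. v \<in> verts K}. verts K)"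

definition contract :: "('a, 'b) pre_digraph \<Rightarrow> ('a, 'b) pre_digraph \<Rightarrow> ('a set, 'b) pre_digraph" where
  "contract G H =
     \<lparr> verts = contraction_map H ` verts G, arcs = arcs G - arcs H,
       tail = contraction_map H \<circ> tail G, head = contraction_map H \<circ> head G \<rparr>"

definition undirected_tree :: "('a, 'b) pre_digraph \<Rightarrow> bool" where
  "undirected_tree T \<longleftrightarrow> Digraph_Component.connected T \<and> (\<nexists>p. circuit T p)"

definition connecting_trees ::
    "('a, 'b) pre_digraph \<Rightarrow> ('a, 'b) pre_digraph \<Rightarrow> ('a set, 'b) pre_digraph set" where
  "connecting_trees G H =
     {T. subgraph T (contract G H) \<and> undirected_tree T \<and> verts ` components H \<subseteq> verts T}"

text \<open>
  For a finite graph the set of weights below is finite, since the edges of such a tree form a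
  subset of the edges of \<open>G\<close>.
\<close>

definition min_tree_weight ::
    "('a, 'b) pre_digraph \<Rightarrow> ('b \<Rightarrow> real) \<Rightarrow> ('b \<Rightarrow>\<^sub>0 int) \<Rightarrow> real" where
  "min_tree_weight G \<mu> \<alpha> =
     Min ((\<lambda>T. \<Sum>e \<in> arcs T. \<mu> e) ` connecting_trees G (chain_supp G \<alpha>))"

end

theory Submission
  imports Defs "HOL-Library.Multiset"
begin

text \<open>
  A closed walk \<open>p\<close> over \<open>\<alpha>\<close> traverses every edge \<open>e\<close> at least \<open>\<bar>c\<^sub>e\<bar>\<close> times, and an edge
  outside \<open>H = supp \<alpha>\<close> equally often in both directions. The edges of \<open>p\<close> outside
  \<open>H\<close> form a connected subgraph of \<open>G|\<^sub>H\<close> through all \<open>w\<^sub>i\<close>, hence contain a connecting tree, every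
  edge of which is used at least twice; this is the lower bound. Conversely, \<open>\<bar>c\<^sub>e\<bar>\<close> copies of
  each edge of \<open>H\<close>, directed by the sign of \<open>c\<^sub>e\<close>, together with both orientations of each
  edge of a minimal tree form a balanced connected multiset, which has an Eulerian closed walk
  of the required length. Deleting its backtracks and tails keeps \<open>\<alpha>\<close> and does not increase the
  length, so that, by the lower bound for closed walks, it ends in a shortest circuit.
\<close>

section \<open>Connectedness by arc-closed vertex sets\<close>

text \<open>Such sets turn connectedness into a closure condition, so that paths need not be
  constructed. \<open>S\<close> may reach beyond \<open>verts K\<close>; preimages under a
  contraction can then be tested directly.\<close>

definition arc_closed :: "('a, 'b) pre_digraph \<Rightarrow> 'a set \<Rightarrow> bool" where
  "arc_closed K S \<longleftrightarrow> (\<forall>e \<in> arcs K. tail K e \<in> S \<longleftrightarrow> head K e \<in> S)"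

lemma arc_closedD: "arc_closed K S \<Longrightarrow> e \<in> arcs K \<Longrightarrow> tail K e \<in> S \<longleftrightarrow> head K e \<in> S"
  by (simp add: arc_closed_def)

lemma arc_closed_subgraph: "arc_closed H S \<Longrightarrow> subgraph K H \<Longrightarrow> arc_closed K S"
  by (auto simp: arc_closed_def subgraph_def compatible_def)

text \<open>Symmetric reachability enters only here. A path never leaves an arc-closed set;
  conversely, the vertices reachable from \<open>u\<close> form an arc-closed set, which must then
  contain everything.\<close>

lemma connected_iff_arc_closed:
  assumes "wf_digraph K"
  shows "Digraph_Component.connected K \<longleftrightarrow>
    verts K \<noteq> {} \<and> (\<forall>S. arc_closed K S \<longrightarrow> verts K \<inter> S \<noteq> {} \<longrightarrow> verts K \<subseteq> S)"
    (is "_ \<longleftrightarrow> ?R")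
proof
  interpret K: wf_digraph K by fact
  let ?r = "parcs (mk_symmetric K)"
  assume con: "Digraph_Component.connected K"
  have "verts K \<subseteq> S" if S: "arc_closed K S" and ne: "verts K \<inter> S \<noteq> {}" for S
  proof
    fix v assume v: "v \<in> verts K"
    obtain u where u: "u \<in> verts K" "u \<in> S" using ne by auto
    have "(u, v) \<in> rtrancl_on (verts K) ?r"
      using con u v unfolding connected_def strongly_connected_def reachable_def by simp
    then show "v \<in> S"
      by (induction rule: rtrancl_on_induct)
        (use u S in \<open>auto simp: parcs_mk_symmetric arc_closed_def\<close>)
  qed
  moreover have "verts K \<noteq> {}" using con unfolding connected_def strongly_connected_def by simp
  ultimately show ?R by blast
next
  interpret K: wf_digraph K by fact
  let ?r = "parcs (mk_symmetric K)"
  assume R: ?R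
  have "(u, v) \<in> rtrancl_on (verts K) ?r" if u: "u \<in> verts K" and v: "v \<in> verts K" for u v
  proof -
    let ?S = "{w. (u, w) \<in> rtrancl_on (verts K) ?r}"
    have "arc_closed K ?S"
      unfolding arc_closed_def
    proof (intro ballI iffI)
      fix e assume e: "e \<in> arcs K"
      have r: "(tail K e, head K e) \<in> ?r" "(head K e, tail K e) \<in> ?r"
        using e by (auto simp: parcs_mk_symmetric)
      show "head K e \<in> ?S" if "tail K e \<in> ?S"
        using that r e by (auto intro: rtrancl_on_into_rtrancl_on)
      show "tail K e \<in> ?S" if "head K e \<in> ?S"
        using that r e by (auto intro: rtrancl_on_into_rtrancl_on)
    qed
    moreover have "u \<in> ?S" using u by simp
    ultimately have "verts K \<subseteq> ?S" using R u by blast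
    then show ?thesis using v by auto
  qed
  then show "Digraph_Component.connected K"
    using R unfolding connected_def strongly_connected_def reachable_def by simp
qed

lemma connectedD:
  assumes "Digraph_Component.connected K" "wf_digraph K" "arc_closed K S" "v \<in> verts K" "v \<in> S"
  shows "verts K \<subseteq> S"
  using assms by (auto simp: connected_iff_arc_closed)

section \<open>Components and contraction\<close>

lemma components_connected:
  assumes "K \<in> components H"
  shows "subgraph K H" "Digraph_Component.connected K" "wf_digraph K" "verts K \<noteq> {}"
proof -
  show "subgraph K H" and c: "Digraph_Component.connected K"
    using assms by (auto simp: components_def pre_digraph.max_subgraph_def)
  then show w: "wf_digraph K" by auto
  show "verts K \<noteq> {}" using c w by (simp add: connected_iff_arc_closed)
qed

lemma component_maximal:
  assumes "K \<in> components H" "subgraph K K'" "subgraph K' H" "Digraph_Component.connected K'"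
  shows "K' = K"
  using assms by (auto simp: components_def pre_digraph.max_subgraph_def)

lemma component_subset_arc_closed:
  assumes "K \<in> components H" "arc_closed H S" "v \<in> verts K" "v \<in> S"
  shows "verts K \<subseteq> S"
  using assms components_connected[OF assms(1)] arc_closed_subgraph connectedD by metis

text \<open>By maximality: an arc with exactly one end in \<open>K\<close> could be added to
  \<open>K\<close> together with its other end, giving a larger connected subgraph.\<close>

lemma arc_closed_component:
  assumes K: "K \<in> components H"
  shows "arc_closed H (verts K)"
  unfolding arc_closed_def
proof (intro ballI)
  fix e assume e: "e \<in> arcs H"
  note KH = components_connected[OF K]
  then interpret H: wf_digraph H by auto
  interpret K: wf_digraph K by (rule KH)
  show "tail H e \<in> verts K \<longleftrightarrow> head H e \<in> verts K"
  proof (rule ccontr)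
    assume ne: "\<not> ?thesis"
    define K' where "K' = \<lparr> verts = verts K \<union> {tail H e, head H e}, arcs = insert e (arcs K),
      tail = tail H, head = head H \<rparr>"
    have th: "tail K = tail H" "head K = head H" and sub: "verts K \<subseteq> verts H" "arcs K \<subseteq> arcs H"
      using KH(1) by (auto simp: subgraph_def compatible_def)
    have wf: "wf_digraph K'"
      using K.tail_in_verts K.head_in_verts by unfold_locales (auto simp: K'_def th)
    have "verts K' \<subseteq> S" if S: "arc_closed K' S" and v: "v \<in> verts K'" "v \<in> S" for S v
    proof -
      have eS: "tail H e \<in> S \<longleftrightarrow> head H e \<in> S"
        using S by (auto simp: arc_closed_def K'_def)
      have cS: "arc_closed K S"
        using S by (auto simp: arc_closed_def K'_def th)
      have "\<exists>w. w \<in> verts K \<and> w \<in> S"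
        using v ne eS by (auto simp: K'_def)
      then have "verts K \<subseteq> S" using connectedD[OF KH(2,3) cS] by blast
      then show ?thesis using ne eS by (auto simp: K'_def)
    qed
    moreover have "verts K' \<noteq> {}" by (simp add: K'_def)
    ultimately have "Digraph_Component.connected K'"
      unfolding connected_iff_arc_closed[OF wf] by blast
    moreover have "subgraph K K'" "subgraph K' H"
      using wf K.wf_digraph H.wf_digraph sub e th
      by (auto simp: subgraph_def compatible_def K'_def)
    ultimately have "K' = K" using component_maximal[OF K] by blast
    then show False using ne by (auto simp: K'_def dest!: arg_cong[of _ K verts])
  qed
qed

text \<open>The component of \<open>v\<close> is the subgraph induced on the smallest arc-closed set
  containing \<open>v\<close>.\<close>

lemma component_exists:
  assumes "wf_digraph H" "v \<in> verts H"
  shows "\<exists>K \<in> components H. v \<in> verts K"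
proof -
  interpret H: wf_digraph H by fact
  define S0 where "S0 = \<Inter> {S. arc_closed H S \<and> v \<in> S}"
  have cl: "arc_closed H S0" unfolding S0_def arc_closed_def by blast
  have v0: "v \<in> S0" by (auto simp: S0_def)
  have min: "S0 \<subseteq> S" if "arc_closed H S" "v \<in> S" for S using that by (auto simp: S0_def)
  have "arc_closed H (verts H)" by (auto simp: arc_closed_def)
  then have S0H: "S0 \<subseteq> verts H" using min assms by blast
  define K where "K = H \<restriction> S0"
  have [simp]: "verts K = S0" "arcs K = {e \<in> arcs H. tail H e \<in> S0 \<and> head H e \<in> S0}"
    "tail K = tail H" "head K = head H"
    by (auto simp: K_def induce_subgraph_def)
  have wf: "wf_digraph K" by unfold_locales auto
  have sub: "subgraph K H"
    using S0H wf H.wf_digraph by (auto simp: subgraph_def compatible_def)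
  \<comment> \<open>An arc of \<open>H\<close> with one end in \<open>S0\<close> has both ends
    there, hence is an arc of \<open>K\<close>; so \<open>S \<inter> S0\<close> and
    \<open>S0 - S\<close> are arc-closed in \<open>H\<close> as well. Whichever of them contains
    \<open>v\<close> is all of \<open>S0\<close> by minimality.\<close>
  have "S0 \<subseteq> S" if S: "arc_closed K S" and w: "w \<in> S0" "w \<in> S" for S w
  proof (cases "v \<in> S")
    case True
    have "arc_closed H (S \<inter> S0)" using S cl by (auto simp: arc_closed_def)
    then show ?thesis using min[of "S \<inter> S0"] True v0 by auto
  next
    case False
    have "arc_closed H (S0 - S)" using S cl by (auto simp: arc_closed_def)
    then show ?thesis using min[of "S0 - S"] False v0 w by auto
  qed
  then have con: "Digraph_Component.connected K"
    using v0 by (auto simp: connected_iff_arc_closed[OF wf])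
  \<comment> \<open>A connected \<open>K'\<close> cannot leave the arc-closed set \<open>S0\<close>,
    and \<open>K\<close> already has every arc of \<open>H\<close> inside \<open>S0\<close>.\<close>
  have "K' = K" if K': "subgraph K K'" "subgraph K' H" "Digraph_Component.connected K'" for K'
  proof -
    interpret K': wf_digraph K' using K' by auto
    have "arc_closed K' S0" using cl K'(2) by (rule arc_closed_subgraph)
    then have "verts K' \<subseteq> S0"
      using connectedD[OF K'(3) K'.wf_digraph] K'(1) v0 by (metis \<open>verts K = S0\<close> subgraph_imp_subverts subsetD)
    moreover have "S0 \<subseteq> verts K'" using K'(1) by (auto simp: subgraph_def)
    ultimately have vs: "verts K' = S0" by simp
    have th: "tail K' = tail H" "head K' = head H" using K'(2) by (auto simp: subgraph_def compatible_def)
    have "arcs K' = arcs K"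
      using K' K'.tail_in_verts K'.head_in_verts
      by (auto simp: subgraph_def compatible_def vs th)
    then show ?thesis using vs th by (intro pre_digraph.equality) auto
  qed
  then have "K \<in> components H"
    using sub con by (auto simp: components_def pre_digraph.max_subgraph_def)
  then show ?thesis using v0 by (intro bexI[of _ K]) simp_all
qed

text \<open>Components that share a vertex have the same vertex set, since each vertex set is
  arc-closed; so all sets in the union coincide.\<close>

lemma contraction_map_component:
  assumes "K \<in> components H" "v \<in> verts K"
  shows "contraction_map H v = verts K"
proof -
  have "verts K' = verts K" if "K' \<in> components H" "v \<in> verts K'" for K'
    using that assms component_subset_arc_closed arc_closed_component by (metis subset_antisym)
  then have "\<forall>K' \<in> {K' \<in> components H. v \<in> verts K'}. verts K' = verts K" by blast
  moreover have "K \<in> {K' \<in> components H. v \<in> verts K'}" using assms by simp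
  ultimately have "(\<Union>K' \<in> {K' \<in> components H. v \<in> verts K'}. verts K') = verts K"
    by (intro UN_constant_eq)
  then show ?thesis using assms(2) unfolding contraction_map_def by (simp only: insert_absorb)
qed

lemma contraction_map_outside:
  assumes "v \<notin> verts H"
  shows "contraction_map H v = {v}"
proof -
  have "v \<notin> verts K" if "K \<in> components H" for K
    using that assms components_connected(1) subgraph_imp_subverts by blast
  then show ?thesis by (auto simp: contraction_map_def)
qed

lemma contraction_map_arc:
  assumes "wf_digraph H" "e \<in> arcs H"
  shows "contraction_map H (tail H e) = contraction_map H (head H e)"
proof -
  obtain K where K: "K \<in> components H" "tail H e \<in> verts K"
    using assms component_exists wf_digraph.tail_in_verts by metis
  moreover have "head H e \<in> verts K" using arc_closedD[OF arc_closed_component[OF K(1)] assms(2)] K(2) by simp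
  ultimately show ?thesis by (simp add: contraction_map_component)
qed

text \<open>The fibres of the contraction are the vertex sets of components and single vertices
  outside \<open>H\<close>; an arc-closed set that meets a fibre contains it.\<close>

lemma contraction_map_arc_closed:
  assumes H: "wf_digraph H" and S: "arc_closed H S"
  shows "contraction_map H v \<in> contraction_map H ` S \<longleftrightarrow> v \<in> S"
proof
  assume "contraction_map H v \<in> contraction_map H ` S"
  then obtain s where s: "s \<in> S" "contraction_map H v = contraction_map H s" by auto
  then have s': "s \<in> contraction_map H v" by (auto simp: contraction_map_def)
  show "v \<in> S"
  proof (cases "v \<in> verts H")
    case True
    then obtain K where K: "K \<in> components H" "v \<in> verts K"
      using component_exists[OF H] by blast
    then have "s \<in> verts K" using s' contraction_map_component by metis
    then show ?thesis using component_subset_arc_closed[OF K(1) S] s K by blast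
  next
    case False
    then show ?thesis using s s' contraction_map_outside by fastforce
  qed
qed simp

lemma contract_simps [simp]:
  "verts (contract G H) = contraction_map H ` verts G"
  "arcs (contract G H) = arcs G - arcs H"
  "tail (contract G H) = contraction_map H \<circ> tail G"
  "head (contract G H) = contraction_map H \<circ> head G"
  by (simp_all add: contract_def)

lemma wf_digraph_contract: "wf_digraph G \<Longrightarrow> wf_digraph (contract G H)"
  by (simp add: wf_digraph_def)

text \<open>The preimage of an arc-closed set is arc-closed in \<open>G\<close>: an arc of
  \<open>H\<close> has both ends in one fibre, and every other arc survives the contraction.\<close>

lemma connected_contract:
  assumes G: "wf_digraph G" "Digraph_Component.connected G" and H: "subgraph H G"
  shows "Digraph_Component.connected (contract G H)"
proof -
  have wfH: "wf_digraph H" and th: "tail H = tail G" "head H = head G"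
    using H by (auto simp: subgraph_def compatible_def)
  have "contraction_map H ` verts G \<subseteq> S"
    if S: "arc_closed (contract G H) S" and v: "v \<in> verts G" "contraction_map H v \<in> S" for S v
  proof -
    have "arc_closed G (contraction_map H -` S)"
      unfolding arc_closed_def
    proof
      fix e assume e: "e \<in> arcs G"
      show "tail G e \<in> contraction_map H -` S \<longleftrightarrow> head G e \<in> contraction_map H -` S"
        using e S contraction_map_arc[OF wfH, of e] by (cases "e \<in> arcs H") (auto simp: arc_closed_def th)
    qed
    then have "verts G \<subseteq> contraction_map H -` S" using connectedD[OF G(2,1)] v by blast
    then show ?thesis by auto
  qed
  then show ?thesis
    using G by (auto simp: connected_iff_arc_closed wf_digraph_contract)
qed

section \<open>Walks and closed walks\<close>

lemma inv_edge_inv_edge [simp]: "inv_edge (inv_edge a) = a"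
  by (cases a) auto

lemma inv_edge_neq [simp]: "inv_edge a \<noteq> a" "a \<noteq> inv_edge a"
  by (cases a; auto)+

lemma fst_inv_edge [simp]: "fst (inv_edge a) = fst a"
  by (cases a) auto

lemma initial_inv_edge [simp]: "initial G (inv_edge a) = terminal G a"
  by (cases a) auto

lemma terminal_inv_edge [simp]: "terminal G (inv_edge a) = initial G a"
  by (cases a) auto

lemma edge_chain_inv_edge [simp]: "edge_chain (inv_edge a) = - edge_chain a"
  by (cases a) auto

lemma fst_eq_iff_inv_edge: "fst a = fst b \<longleftrightarrow> a = b \<or> a = inv_edge b"
  by (cases a; cases b) auto

lemma oriented_edges_iff: "a \<in> oriented_edges G \<longleftrightarrow> fst a \<in> arcs G"
  by (cases a) (auto simp: oriented_edges_def)

lemma initial_in_iff_terminal_in: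
  "(initial G a \<in> S \<longleftrightarrow> terminal G a \<in> S) \<longleftrightarrow> (tail G (fst a) \<in> S \<longleftrightarrow> head G (fst a) \<in> S)"
  by (cases a) auto

lemma initial_or_terminal:
  assumes "v = tail G (fst a) \<or> v = head G (fst a)"
  shows "v = initial G a \<or> v = terminal G a"
  using assms by (cases a) auto

lemma initial_in_ends: "initial G a \<in> {tail G (fst a), head G (fst a)}"
  by (cases a) auto

lemma initial_in_verts: "wf_digraph G \<Longrightarrow> fst a \<in> arcs G \<Longrightarrow> initial G a \<in> verts G"
  by (cases a) (auto simp: wf_digraph_def)

lemma walk_append:
  assumes "p \<noteq> []" "q \<noteq> []"
  shows "walk G (p @ q) \<longleftrightarrow> walk G p \<and> walk G q \<and> initial G (hd q) = terminal G (last p)"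
  using assms by (auto simp: walk_def successively_append_iff)

lemma walk_Cons:
  "walk G (a # p) \<longleftrightarrow> a \<in> oriented_edges G \<and>
    (p = [] \<or> walk G p \<and> initial G (hd p) = terminal G a)"
  by (cases p) (auto simp: walk_def)

lemma closed_walk_append:
  assumes "closed_walk G p" "closed_walk G q" "initial G (hd p) = initial G (hd q)"
  shows "closed_walk G (p @ q)"
proof -
  have "p \<noteq> []" "q \<noteq> []" using assms by (auto simp: closed_walk_def walk_def)
  then show ?thesis using assms by (auto simp: closed_walk_def walk_append)
qed

lemma closed_walk_rotate:
  assumes "closed_walk G (p @ q)"
  shows "closed_walk G (q @ p)"
  using assms by (cases "p = []"; cases "q = []") (auto simp: closed_walk_def walk_append)

lemma closed_walk_drop_backtrack:
  assumes "closed_walk G (a # inv_edge a # r)" "r \<noteq> []"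
  shows "closed_walk G r"
  using assms by (auto simp: closed_walk_def walk_Cons)

text \<open>Each inner vertex of the walk is the end of one oriented edge and the start of the next,
  so the two multisets differ only by the two ends of the walk.\<close>

lemma walk_balance:
  assumes "walk G p"
  shows "add_mset (terminal G (last p)) (image_mset (initial G) (mset p)) =
    add_mset (initial G (hd p)) (image_mset (terminal G) (mset p))"
  using assms
proof (induction p)
  case (Cons a p)
  then show ?case by (cases "p = []") (auto simp: walk_Cons)
qed (simp add: walk_def)

lemma closed_walk_balance:
  assumes "closed_walk G p"
  shows "image_mset (initial G) (mset p) = image_mset (terminal G) (mset p)"
  using assms walk_balance[of G p] by (simp add: closed_walk_def)

lemma closed_walk_terminal_set:
  assumes "closed_walk G p"
  shows "terminal G ` set p = initial G ` set p"
  using arg_cong[OF closed_walk_balance[OF assms], of set_mset] by simp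

text \<open>The counterpart of arc-closedness for walks: a set that no edge of the walk enters or
  leaves contains all of its vertices or none.\<close>

lemma walk_stays_in:
  assumes "walk G p" "\<And>a. a \<in> set p \<Longrightarrow> initial G a \<in> S \<longleftrightarrow> terminal G a \<in> S" "a \<in> set p"
  shows "initial G a \<in> S \<longleftrightarrow> initial G (hd p) \<in> S"
  using assms
proof (induction p)
  case (Cons b p)
  show ?case
  proof (cases "a = b")
    case False
    then have p: "a \<in> set p" "walk G p" "initial G (hd p) = terminal G b"
      using Cons.prems by (auto simp: walk_Cons)
    have "initial G a \<in> S \<longleftrightarrow> initial G (hd p) \<in> S" using Cons p by simp
    then show ?thesis using p Cons.prems(2)[of b] by simp
  qed simp
qed simp

lemma walk_ends_in:
  assumes "walk G p" "\<And>a. a \<in> set p \<Longrightarrow> initial G a \<in> S \<longleftrightarrow> terminal G a \<in> S"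
  shows "terminal G (last p) \<in> S \<longleftrightarrow> initial G (hd p) \<in> S"
proof -
  have "last p \<in> set p" using assms(1) by (simp add: walk_def)
  then show ?thesis using walk_stays_in[OF assms] assms(2) by blast
qed

section \<open>Reduction of closed walks to circuits\<close>

lemma not_successivelyD:
  assumes "\<not> successively P p"
  obtains xs a b ys where "p = xs @ a # b # ys" "\<not> P a b"
proof -
  have "\<exists>xs a b ys. p = xs @ a # b # ys \<and> \<not> P a b"
    using assms
  proof (induction P p rule: successively.induct)
    case (3 P x y xs)
    show ?case
    proof (cases "P x y")
      case True
      then obtain ys a b zs where "y # xs = ys @ a # b # zs" "\<not> P a b" using 3 by auto
      then have "x # y # xs = (x # ys) @ a # b # zs" by simp
      then show ?thesis using \<open>\<not> P a b\<close> by blast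
    next
      case False
      then show ?thesis by (metis append_Nil)
    qed
  qed auto
  then show thesis using that by blast
qed

text \<open>A tail is a backtrack across the ends of the closed walk. Allowing a rotation brings
  both defects to the front in the same form.\<close>

lemma not_circuitD:
  assumes "closed_walk G p" "\<not> circuit G p"
  obtains xs ys a r where "p = xs @ ys" "ys @ xs = a # inv_edge a # r"
proof (cases "has_backtrack p")
  case True
  then have "\<not> successively (\<lambda>a a'. a' \<noteq> inv_edge a) p" by (simp add: has_backtrack_def)
  then obtain xs a b ys where "p = xs @ a # b # ys" "\<not> b \<noteq> inv_edge a"
    by (rule not_successivelyD)
  then have "p = xs @ a # inv_edge a # ys" by simp
  then show thesis using that[of xs "a # inv_edge a # ys"] by simp
next
  case False
  then have "has_tail p" using assms by (auto simp: circuit_def)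
  then have hd: "hd p = inv_edge (last p)" by (simp add: has_tail_def)
  have "p \<noteq> []" using assms by (auto simp: closed_walk_def walk_def)
  then obtain q a where q: "p = q @ [a]" using rev_exhaust by blast
  \<comment> \<open>A single oriented edge has no tail, since it differs from its inverse.\<close>
  moreover have "q \<noteq> []" using hd q by auto
  then obtain b r where r: "q = b # r" by (cases q) auto
  moreover have "b = inv_edge a" using hd q r by simp
  ultimately show thesis using that[of q "[a]"] by simp
qed

lemma abelianization_append [simp]:
  "abelianization (p @ q) = abelianization p + abelianization q"
  by (simp add: abelianization_def)

lemma abelianization_Cons: "abelianization (a # p) = edge_chain a + abelianization p"
  by (simp add: abelianization_def)

lemma abelianization_Nil [simp]: "abelianization [] = 0"
  by (simp add: abelianization_def)

lemma circuit_of_closed_walk: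
  assumes "closed_walk G p" "abelianization p \<noteq> 0" "\<forall>e \<in> arcs G. 0 < \<mu> e"
  shows "\<exists>q. circuit G q \<and> abelianization q = abelianization p \<and> walk_length \<mu> q \<le> walk_length \<mu> p"
  using assms(1,2)
proof (induction "length p" arbitrary: p rule: less_induct)
  case less
  show ?case
  proof (cases "circuit G p")
    case True
    then show ?thesis by blast
  next
    case False
    then obtain xs ys a r where p: "p = xs @ ys" and r: "ys @ xs = a # inv_edge a # r"
      using not_circuitD less by metis
    have cw: "closed_walk G (a # inv_edge a # r)"
      using closed_walk_rotate less(2) p r by metis
    have "abelianization p = abelianization (ys @ xs)" by (simp add: p add.commute)
    then have ab: "abelianization p = abelianization r" by (simp add: r abelianization_Cons)
    have "length p = length (ys @ xs)" by (simp add: p)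
    then have len: "length r < length p" by (simp add: r)
    \<comment> \<open>Here the nonzero abelianization is essential: otherwise cancellation might
      consume the whole walk.\<close>
    have "r \<noteq> []" using ab less(3) by auto
    then have "closed_walk G r" using closed_walk_drop_backtrack cw by blast
    then obtain q where q: "circuit G q" "abelianization q = abelianization p"
      "walk_length \<mu> q \<le> walk_length \<mu> r"
      using less(1)[OF len] ab less(3) by auto
    have "fst a \<in> arcs G" using cw by (simp add: closed_walk_def walk_Cons oriented_edges_iff)
    then have "0 < \<mu> (fst a)" using assms(3) by simp
    moreover have "walk_length \<mu> p = walk_length \<mu> (ys @ xs)" by (simp add: p walk_length_def)
    ultimately have "walk_length \<mu> r \<le> walk_length \<mu> p" by (simp add: r walk_length_def)
    then show ?thesis using q by force
  qed
qed

section \<open>Spanning trees\<close>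

text \<open>
  A circuit may repeat edges, even in opposite directions (a bridge between two loops), so an
  edge that can be deleted is sought on a shortest closed walk without backtracks.
\<close>

lemma shortest_backtrack_free_closed_walk:
  assumes "closed_walk G p" "\<not> has_backtrack p"
  obtains a r where "closed_walk G (a # r)" "fst a \<notin> fst ` set r"
proof -
  obtain c where c: "closed_walk G c" "\<not> has_backtrack c"
    and min: "\<And>d. closed_walk G d \<Longrightarrow> \<not> has_backtrack d \<Longrightarrow> length c \<le> length d"
    using ex_has_least_nat[of "\<lambda>c. closed_walk G c \<and> \<not> has_backtrack c" p length] assms by blast
  \<comment> \<open>Between two visits of a vertex lies a shorter closed walk \<open>x # ys\<close>.
    It may have a tail, but as a segment of \<open>c\<close> it has no backtrack, which is why only
    backtracks are excluded in the choice of \<open>c\<close>.\<close>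
  have dist: "distinct (map (initial G) c)"
  proof (rule ccontr)
    assume "\<not> ?thesis"
    then obtain us vs ws v where "map (initial G) c = us @ [v] @ vs @ [v] @ ws"
      using not_distinct_decomp by blast
    then have "map (initial G) c = us @ v # vs @ v # ws" by simp
    then obtain xs c1 where c1: "c = xs @ c1" "map (initial G) c1 = v # vs @ v # ws"
      unfolding map_eq_append_conv by metis
    then obtain x c2 where c2: "c1 = x # c2" "initial G x = v" "map (initial G) c2 = vs @ v # ws"
      unfolding map_eq_Cons_conv by metis
    then obtain ys c3 where c3: "c2 = ys @ c3" "map (initial G) c3 = v # ws"
      unfolding map_eq_append_conv by metis
    then obtain y zs where "c3 = y # zs" "initial G y = v"
      unfolding map_eq_Cons_conv by metis
    then have c': "c = xs @ (x # ys) @ y # zs" and xy: "initial G x = initial G y"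
      using c1 c2 c3 by simp_all
    have w: "walk G (xs @ (x # ys) @ y # zs)" using c c' by (simp add: closed_walk_def)
    then have "walk G ((x # ys) @ y # zs)" by (cases "xs = []") (auto simp: walk_append)
    then have "closed_walk G (x # ys)"
      using xy walk_append[of "x # ys" "y # zs" G] by (auto simp: closed_walk_def)
    moreover have "\<not> has_backtrack (x # ys)"
      using c(2) unfolding has_backtrack_def c' successively_append_iff by auto
    ultimately show False using min[of "x # ys"] c' by simp
  qed
  have "c \<noteq> []" using c by (auto simp: closed_walk_def walk_def)
  then obtain a r where ar: "c = a # r" by (cases c) auto
  have "fst b \<noteq> fst a" if b: "b \<in> set r" for b
  proof
    assume "fst b = fst a"
    then consider "b = a" | "b = inv_edge a" by (auto simp: fst_eq_iff_inv_edge)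
    then show False
    proof cases
      case 1
      then show False using dist b ar by force
    next
      case 2
      \<comment> \<open>If \<open>a\<close> returned inverted, that occurrence would start where the
        second edge \<open>d\<close> starts, so it would be \<open>d\<close> itself and form a
        backtrack with \<open>a\<close>.\<close>
      obtain d s where r: "r = d # s" using b by (cases r) auto
      have "initial G d = terminal G a" using c ar r by (simp add: closed_walk_def walk_Cons)
      then have "initial G d = initial G b" using 2 by simp
      then have "d = b" using dist b ar r by auto
      then show False using c(2) 2 ar r by (simp add: has_backtrack_def)
    qed
  qed
  then have "fst a \<notin> fst ` set r" by (metis imageE)
  then show thesis using that[of a r] c(1) ar by simp
qed

text \<open>The remaining walk \<open>r\<close> joins the two ends of the deleted arc without using
  it, so a set that is arc-closed after the deletion was so before. If \<open>r\<close> is empty,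
  the arc is a loop.\<close>

lemma connected_del_arc:
  assumes K: "wf_digraph K" "Digraph_Component.connected K"
    and c: "closed_walk K (a # r)" "fst a \<notin> fst ` set r"
  shows "Digraph_Component.connected (pre_digraph.del_arc K (fst a))"
proof -
  let ?D = "pre_digraph.del_arc K (fst a)"
  interpret K: wf_digraph K by fact
  have "verts K \<subseteq> S" if S: "arc_closed ?D S" and v: "v \<in> verts K" "v \<in> S" for S v
  proof -
    have r: "initial K b \<in> S \<longleftrightarrow> terminal K b \<in> S" if b: "b \<in> set r" for b
    proof -
      have "fst b \<in> arcs K" using b c(1) by (auto simp: closed_walk_def walk_def oriented_edges_iff)
      moreover have "fst b \<noteq> fst a" using b c(2) by (metis image_eqI)
      ultimately show ?thesis
        using S by (auto simp: initial_in_iff_terminal_in arc_closed_def K.del_arc_def)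
    qed
    have "initial K a \<in> S \<longleftrightarrow> terminal K a \<in> S"
    proof (cases "r = []")
      case True
      then show ?thesis using c(1) by (simp add: closed_walk_def)
    next
      case False
      then have "walk K r" "initial K (hd r) = terminal K a" "terminal K (last r) = initial K a"
        using c(1) by (auto simp: closed_walk_def walk_Cons)
      then show ?thesis using walk_ends_in[of K r S] r by metis
    qed
    then have "arc_closed K S"
      using S by (auto simp: initial_in_iff_terminal_in arc_closed_def K.del_arc_def)
    then show ?thesis using connectedD[OF K(2,1)] v by blast
  qed
  moreover have "verts K \<noteq> {}" using K by (simp add: connected_iff_arc_closed)
  moreover have "verts ?D = verts K" by (simp add: K.del_arc_def)
  ultimately show ?thesis
    unfolding connected_iff_arc_closed[OF K.wf_digraph_del_arc] by auto
qed

lemma spanning_tree_exists: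
  assumes K: "wf_digraph K" "Digraph_Component.connected K" and fin: "finite (arcs K)"
  shows "\<exists>T. subgraph T K \<and> verts T = verts K \<and> undirected_tree T"
proof -
  \<comment> \<open>In a connected spanning subgraph with the fewest arcs no arc lies on a cycle.\<close>
  let ?P = "\<lambda>T. subgraph T K \<and> verts T = verts K \<and> Digraph_Component.connected T"
  have "?P K" using K wf_digraph.subgraph_refl by blast
  then obtain T where T: "?P T" and min: "\<And>T'. ?P T' \<Longrightarrow> card (arcs T) \<le> card (arcs T')"
    using ex_has_least_nat[of ?P K "\<lambda>T. card (arcs T)"] by blast
  then interpret T: wf_digraph T by auto
  have finT: "finite (arcs T)" using T fin by (meson finite_subset subgraph_def)
  have "\<not> circuit T p" for p
  proof
    assume "circuit T p"
    then obtain a r where c: "closed_walk T (a # r)" "fst a \<notin> fst ` set r"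
      using shortest_backtrack_free_closed_walk unfolding circuit_def by metis
    have a: "fst a \<in> arcs T" using c by (simp add: closed_walk_def walk_Cons oriented_edges_iff)
    have "?P (T.del_arc (fst a))"
      using connected_del_arc[OF T.wf_digraph _ c] T subgraph_trans[OF T.subgraph_del_arc]
      by (auto simp: T.del_arc_def)
    then have "card (arcs T) \<le> card (arcs (T.del_arc (fst a)))" by (rule min)
    then have "card (arcs T) \<le> card (arcs T - {fst a})" by (simp add: T.del_arc_def)
    then show False using card_Diff1_less[OF finT a] by simp
  qed
  then show ?thesis using T by (auto simp: undirected_tree_def)
qed

section \<open>Eulerian closed walks\<close>

lemma maximal_list_in_mset:
  assumes "P p" "mset p \<subseteq># M"
  obtains q where "P q" "mset q \<subseteq># M"
    "\<And>q'. P q' \<Longrightarrow> mset q' \<subseteq># M \<Longrightarrow> length q' \<le> length q"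
proof -
  have bd: "length q < Suc (size M)" if "mset q \<subseteq># M" for q
    using size_mset_mono[OF that] by simp
  have "\<exists>q. (P q \<and> mset q \<subseteq># M) \<and> (\<forall>q'. P q' \<and> mset q' \<subseteq># M \<longrightarrow> length q' \<le> length q)"
  proof (rule ex_has_greatest_nat)
    show "P p \<and> mset p \<subseteq># M" using assms ..
    show "\<forall>q. P q \<and> mset q \<subseteq># M \<longrightarrow> length q < Suc (size M)" using bd by blast
  qed
  then show thesis using that by blast
qed

lemma closed_trail_exists:
  assumes M: "set_mset M \<subseteq> oriented_edges G" "image_mset (initial G) M = image_mset (terminal G) M"
    and a: "a \<in># M"
  obtains p where "closed_walk G p" "mset p \<subseteq># M" "hd p = a"
proof -
  have "walk G [a]" using a M by (auto simp: walk_def)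
  then have "walk G [a] \<and> hd [a] = a" "mset [a] \<subseteq># M" using a by simp_all
  then obtain p where p': "walk G p \<and> hd p = a" and p3: "mset p \<subseteq># M"
    and max: "\<And>q. walk G q \<and> hd q = a \<Longrightarrow> mset q \<subseteq># M \<Longrightarrow> length q \<le> length p"
    using maximal_list_in_mset[of "\<lambda>p. walk G p \<and> hd p = a" "[a]" M] by blast
  note p = conjunct1[OF p'] conjunct2[OF p'] p3
  have "terminal G (last p) = initial G a"
  proof (rule ccontr)
    assume ne: "\<not> ?thesis"
    define R where "R = M - mset p"
    have MR: "M = mset p + R" using p by (simp add: R_def)
    have "image_mset (initial G) (mset p) + image_mset (initial G) R
        = image_mset (terminal G) (mset p) + image_mset (terminal G) R"
      using M(2) by (simp add: MR)
    then have "add_mset (terminal G (last p)) (image_mset (initial G) (mset p)) + image_mset (initial G) R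
        = image_mset (terminal G) (mset p) + add_mset (terminal G (last p)) (image_mset (terminal G) R)"
      by simp
    then have "add_mset (initial G a) (image_mset (initial G) R) =
        add_mset (terminal G (last p)) (image_mset (terminal G) R)"
      unfolding walk_balance[OF p(1)] p(2) by simp
    then have "terminal G (last p) \<in># image_mset (initial G) R"
      using ne by (metis insert_noteq_member)
    then obtain b where b: "b \<in># R" "initial G b = terminal G (last p)" by auto
    have pne: "p \<noteq> []" using p by (auto simp: walk_def)
    have "b \<in> oriented_edges G" using b M MR by auto
    then have "walk G (p @ [b])" using p b pne by (auto simp: walk_append walk_Cons)
    moreover have "mset (p @ [b]) \<subseteq># M" using b MR by (simp add: mset_subset_eq_single)
    ultimately show False using max[of "p @ [b]"] p pne by simp
  qed
  then show thesis using that p by (simp add: closed_walk_def)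
qed

text \<open>Hierholzer's argument: a longest closed walk in \<open>M\<close> leaves a balanced rest,
  and a rest touching the walk could be spliced in. \<open>con\<close> states connectedness of the
  edges of \<open>M\<close> in the arc-closed form.\<close>

lemma eulerian_closed_walk:
  assumes M: "set_mset M \<subseteq> oriented_edges G" "image_mset (initial G) M = image_mset (terminal G) M"
    and ne: "M \<noteq> {#}"
    and con: "\<And>S. (\<And>a. a \<in># M \<Longrightarrow> initial G a \<in> S \<longleftrightarrow> terminal G a \<in> S) \<Longrightarrow>
      (\<exists>a. a \<in># M \<and> initial G a \<in> S) \<Longrightarrow> (\<forall>a. a \<in># M \<longrightarrow> initial G a \<in> S)"
  obtains p where "closed_walk G p" "mset p = M"
proof -
  obtain a where "a \<in># M" using ne by blast
  then obtain p0 where "closed_walk G p0" "mset p0 \<subseteq># M"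
    using closed_trail_exists[OF M] by blast
  then obtain p where p: "closed_walk G p" "mset p \<subseteq># M"
    and max: "\<And>q. closed_walk G q \<Longrightarrow> mset q \<subseteq># M \<Longrightarrow> length q \<le> length p"
    using maximal_list_in_mset[of "closed_walk G" p0 M] by blast
  have pne: "p \<noteq> []" using p by (auto simp: closed_walk_def walk_def)
  define R where "R = M - mset p"
  have MR: "M = mset p + R" using p by (simp add: R_def)
  have R: "set_mset R \<subseteq> oriented_edges G" "image_mset (initial G) R = image_mset (terminal G) R"
    using M closed_walk_balance[OF p(1)] by (auto simp: MR)
  let ?S = "initial G ` set p"
  have free: "initial G b \<notin> ?S" if b: "b \<in># R" for b
  proof
    assume "initial G b \<in> ?S"
    then obtain c where c: "c \<in> set p" "initial G c = initial G b" by auto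
    then obtain xs ys where xy: "p = xs @ c # ys" by (meson split_list)
    obtain q where q: "closed_walk G q" "mset q \<subseteq># R" "hd q = b"
      using closed_trail_exists[OF R b] by blast
    \<comment> \<open>Rotated to begin with \<open>c\<close>, the walk \<open>p\<close> can be
      joined to the closed trail \<open>q\<close> at their common start.\<close>
    have "closed_walk G (q @ (c # ys) @ xs)"
      using closed_walk_append[OF q(1) closed_walk_rotate[of G xs "c # ys"]] p xy c q by simp
    moreover have "mset (q @ (c # ys) @ xs) \<subseteq># M"
      using q(2) by (simp add: MR xy ac_simps)
    moreover have "q \<noteq> []" using q by (auto simp: closed_walk_def walk_def)
    ultimately show False using max[of "q @ (c # ys) @ xs"] by (simp add: xy)
  qed
  have "initial G b \<in> ?S \<longleftrightarrow> terminal G b \<in> ?S" if b: "b \<in># M" for b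
  proof (cases "b \<in># R")
    case True
    have "terminal G b \<in># image_mset (initial G) R" using R(2) True by simp
    then obtain c where "c \<in># R" "initial G c = terminal G b"
      unfolding in_image_mset by (metis imageE)
    then show ?thesis using free[of c] free[OF True] by metis
  next
    case False
    then have "b \<in> set p" using b MR by auto
    then show ?thesis using closed_walk_terminal_set[OF p(1)] by blast
  qed
  moreover have "\<exists>a. a \<in># M \<and> initial G a \<in> ?S" using pne MR by (intro exI[of _ "hd p"]) auto
  ultimately have "\<forall>a. a \<in># M \<longrightarrow> initial G a \<in> ?S" using con by blast
  then have "R = {#}" using free MR by (metis multiset_nonemptyE union_iff)
  then show thesis using that p MR by simp
qed

section \<open>Counting traversals\<close>

lemma lookup_abelianization:
  "Poly_Mapping.lookup (abelianization p) e =
    int (count (mset p) (e, True)) - int (count (mset p) (e, False))"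
proof (induction p)
  case (Cons a p)
  obtain e' b where "a = (e', b)" by (cases a)
  then show ?case using Cons by (simp add: abelianization_Cons lookup_add)
qed simp

lemma walk_length_count:
  assumes "finite A" "fst ` set p \<subseteq> A"
  shows "walk_length \<mu> p =
    (\<Sum>e\<in>A. (real (count (mset p) (e, True)) + real (count (mset p) (e, False))) * \<mu> e)"
  using assms(2)
proof (induction p)
  case Nil
  then show ?case by (simp add: walk_length_def)
next
  case (Cons a p)
  obtain e' b where a: "a = (e', b)" by (cases a)
  have "(real (count (mset (a # p)) (e, True)) + real (count (mset (a # p)) (e, False))) * \<mu> e =
      (if e = e' then \<mu> e' else 0) +
      (real (count (mset p) (e, True)) + real (count (mset p) (e, False))) * \<mu> e" for e
    by (cases b) (simp_all add: a algebra_simps)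
  then show ?case
    using Cons assms(1) by (simp add: a sum.distrib walk_length_def)
qed

lemma finite_oriented_edges: "finite (arcs G) \<Longrightarrow> finite (oriented_edges G)"
  by (simp add: oriented_edges_def)

lemma deg_edge_inv_edge: "deg_edge \<alpha> (inv_edge a) = - deg_edge \<alpha> a"
  by (cases a) auto

lemma count_image_mset_sum:
  assumes "finite A" "set_mset M \<subseteq> A"
  shows "count (image_mset g M) v = (\<Sum>a \<in> {a \<in> A. g a = v}. count M a)"
  unfolding count_image_mset
  by (rule sum.mono_neutral_left) (use assms in \<open>auto simp: not_in_iff\<close>)

text \<open>Inversion is a bijection from the oriented edges starting at \<open>v\<close> to those
  ending there, so the excess of starts over ends at \<open>v\<close> is the degree of \<alpha> at
  \<open>v\<close>.\<close>

lemma image_mset_initial_eq_terminal: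
  assumes fin: "finite (arcs G)" and M: "set_mset M \<subseteq> oriented_edges G"
    and deg: "\<And>v. deg_vertex G \<alpha> v = 0"
    and c: "\<And>a. a \<in> oriented_edges G \<Longrightarrow> int (count M a) - int (count M (inv_edge a)) = deg_edge \<alpha> a"
  shows "image_mset (initial G) M = image_mset (terminal G) M"
proof (rule multiset_eqI)
  fix v
  note cnt = count_image_mset_sum[OF finite_oriented_edges[OF fin] M]
  let ?A = "{a \<in> oriented_edges G. initial G a = v}"
  have "count (image_mset (terminal G) M) v = (\<Sum>a \<in> ?A. count M (inv_edge a))"
    unfolding cnt
    by (rule sum.reindex_bij_witness[of _ inv_edge inv_edge]) (simp_all add: oriented_edges_iff)
  then have "int (count (image_mset (initial G) M) v) - int (count (image_mset (terminal G) M) v)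
      = (\<Sum>a \<in> ?A. int (count M a) - int (count M (inv_edge a)))"
    by (simp add: cnt sum_subtractf)
  also have "\<dots> = deg_vertex G \<alpha> v"
    unfolding deg_vertex_def by (intro sum.cong refl c) simp
  finally show "count (image_mset (initial G) M) v = count (image_mset (terminal G) M) v"
    using deg by simp
qed

section \<open>Closed walks and connecting trees\<close>

lemma chain_supp_simps [simp]:
  "verts (chain_supp G \<alpha>) = tail G ` Poly_Mapping.keys \<alpha> \<union> head G ` Poly_Mapping.keys \<alpha>"
  "arcs (chain_supp G \<alpha>) = Poly_Mapping.keys \<alpha>"
  "tail (chain_supp G \<alpha>) = tail G" "head (chain_supp G \<alpha>) = head G"
  by (simp_all add: chain_supp_def)

lemma wf_digraph_chain_supp: "wf_digraph (chain_supp G \<alpha>)"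
  by (auto simp: wf_digraph_def)

lemma subgraph_chain_supp:
  assumes "wf_digraph G" "\<alpha> \<in> C1 G"
  shows "subgraph (chain_supp G \<alpha>) G"
  using assms wf_digraph_chain_supp[of G \<alpha>]
  by (auto simp: subgraph_def compatible_def C1_def wf_digraph_def)

lemma connecting_treesD:
  assumes "T \<in> connecting_trees G H"
  shows "wf_digraph T" "Digraph_Component.connected T" "arcs T \<subseteq> arcs G - arcs H"
    "tail T = contraction_map H \<circ> tail G" "head T = contraction_map H \<circ> head G"
    "K \<in> components H \<Longrightarrow> verts K \<in> verts T"
  using assms by (auto simp: connecting_trees_def subgraph_def compatible_def undirected_tree_def)

lemma contraction_map_in_connecting_tree:
  assumes T: "T \<in> connecting_trees G (chain_supp G \<alpha>)"
    and a: "fst a \<in> arcs T \<or> fst a \<in> Poly_Mapping.keys \<alpha>"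
  shows "contraction_map (chain_supp G \<alpha>) (initial G a) \<in> verts T"
  using a
proof
  assume "fst a \<in> arcs T"
  then have "tail T (fst a) \<in> verts T" "head T (fst a) \<in> verts T"
    using connecting_treesD(1)[OF T] by (simp_all add: wf_digraph_def)
  then show ?thesis
    unfolding connecting_treesD(4,5)[OF T] using initial_in_ends[of G a] by (auto simp del: initial.simps)
next
  assume "fst a \<in> Poly_Mapping.keys \<alpha>"
  then have "initial G a \<in> verts (chain_supp G \<alpha>)" using initial_in_ends[of G a] by auto
  then obtain K where K: "K \<in> components (chain_supp G \<alpha>)" "initial G a \<in> verts K"
    by (rule bexE[OF component_exists[OF wf_digraph_chain_supp]])
  show ?thesis
    unfolding contraction_map_component[OF K] by (rule connecting_treesD(6)[OF T K(1)])
qed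

text \<open>Connectedness in \<open>G\<close> of the tree edges together with the support. As
  \<open>S\<close> is a union of fibres, its image is arc-closed in \<open>T\<close>; the
  connectedness of \<open>T\<close> is applied there and pulled back.\<close>

lemma connecting_tree_arc_closed:
  assumes T: "T \<in> connecting_trees G (chain_supp G \<alpha>)"
    and S: "\<And>e. e \<in> arcs T \<union> Poly_Mapping.keys \<alpha> \<Longrightarrow> tail G e \<in> S \<longleftrightarrow> head G e \<in> S"
    and a: "fst a \<in> arcs T \<union> Poly_Mapping.keys \<alpha>" "initial G a \<in> S"
    and b: "fst b \<in> arcs T \<union> Poly_Mapping.keys \<alpha>"
  shows "initial G b \<in> S"
proof -
  let ?H = "chain_supp G \<alpha>" and ?\<pi> = "contraction_map (chain_supp G \<alpha>)"
  have "arc_closed ?H S" using S by (auto simp: arc_closed_def)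
  note \<pi> = contraction_map_arc_closed[OF wf_digraph_chain_supp this]
  have "arc_closed T (?\<pi> ` S)"
    using S by (auto simp: arc_closed_def connecting_treesD(4,5)[OF T] \<pi>)
  moreover have "?\<pi> (initial G a) \<in> verts T" "?\<pi> (initial G b) \<in> verts T"
    using a b contraction_map_in_connecting_tree[OF T] by auto
  moreover have "?\<pi> (initial G a) \<in> ?\<pi> ` S" using a by simp
  ultimately have "?\<pi> (initial G b) \<in> ?\<pi> ` S"
    using connectedD[OF connecting_treesD(2,1)[OF T]] by blast
  then show ?thesis by (simp add: \<pi>)
qed

lemma closed_walk_of_connecting_tree:
  assumes G: "fin_digraph G" and \<alpha>: "\<alpha> \<in> H1 G" "\<alpha> \<noteq> 0"
    and T: "T \<in> connecting_trees G (chain_supp G \<alpha>)"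
  obtains p where "closed_walk G p" "abelianization p = \<alpha>"
    "walk_length \<mu> p = 2 * (\<Sum>e \<in> arcs T. \<mu> e) + chain_norm G \<mu> \<alpha>"
proof -
  interpret G: fin_digraph G by fact
  let ?A = "oriented_edges G" and ?c = "Poly_Mapping.lookup \<alpha>"
  have keys: "Poly_Mapping.keys \<alpha> \<subseteq> arcs G" using \<alpha> by (simp add: H1_def C1_def)
  have Tarcs: "arcs T \<subseteq> arcs G - Poly_Mapping.keys \<alpha>" using connecting_treesD(3)[OF T] by simp
  have c0: "?c e = 0" if "e \<in> arcs T" for e using Tarcs that by (auto simp: in_keys_iff)
  have finA: "finite ?A" by (simp add: finite_oriented_edges)
  \<comment> \<open>Every tree edge is taken once in each direction. Elsewhere \<open>nat\<close>
    gives 0 in the direction against the sign of the coefficient, and its absolute value in the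
    other.\<close>
  define f where "f a = (if fst a \<in> arcs T then 1 else nat (deg_edge \<alpha> a))" for a
  define M where "M = (\<Sum>a \<in> ?A. replicate_mset (f a) a)"
  have f0: "f a = 0" if "a \<notin> ?A" for a
  proof (cases a)
    case (Pair e b)
    have "e \<notin> arcs T" "?c e = 0" using that keys Tarcs Pair by (auto simp: oriented_edges_iff in_keys_iff)
    then show ?thesis by (simp add: f_def Pair)
  qed
  have count: "count M a = f a" for a
    using finA f0 by (auto simp: M_def count_sum if_distrib cong: if_cong)
  have inM: "a \<in># M \<longleftrightarrow> f a \<noteq> 0" for a by (metis count count_eq_zero_iff)
  have M: "set_mset M \<subseteq> ?A" using f0 inM by blast
  have Mfst: "fst a \<in> arcs T \<union> Poly_Mapping.keys \<alpha>" if "a \<in># M" for a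
    using that by (cases a) (auto simp: inM f_def in_keys_iff split: if_splits)
  have Mex: "\<exists>a. a \<in># M \<and> fst a = e" if e: "e \<in> arcs T \<union> Poly_Mapping.keys \<alpha>" for e
  proof -
    have "f (e, True) \<noteq> 0 \<or> f (e, False) \<noteq> 0"
      using e by (auto simp: f_def in_keys_iff)
    then show ?thesis by (metis inM fst_conv)
  qed
  \<comment> \<open>Membership in \<open>H1\<close> only speaks of vertices of \<open>G\<close>; at
    any other point the sum is empty.\<close>
  have deg: "deg_vertex G \<alpha> v = 0" for v
  proof (cases "v \<in> verts G")
    case False
    have "v \<in> verts G" if "a \<in> ?A" "initial G a = v" for a
      using initial_in_verts[OF G.wf_digraph, of a] that by (simp add: oriented_edges_iff)
    then have "{a \<in> ?A. initial G a = v} = {}" using False by blast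
    then show ?thesis unfolding deg_vertex_def by (simp only: sum.empty)
  qed (use \<alpha> in \<open>simp add: H1_def\<close>)
  \<comment> \<open>The two copies of a tree edge cancel, matching its coefficient 0; elsewhere this
    is \<open>int (nat x) - int (nat (- x)) = x\<close>.\<close>
  have diff: "int (f a) - int (f (inv_edge a)) = deg_edge \<alpha> a" for a
  proof (cases "fst a \<in> arcs T")
    case True
    then show ?thesis using c0 by (cases a) (simp add: f_def)
  qed (simp add: f_def deg_edge_inv_edge)
  have bal: "image_mset (initial G) M = image_mset (terminal G) M"
    by (rule image_mset_initial_eq_terminal[OF _ M deg]) (simp_all add: count diff)
  have "Poly_Mapping.keys \<alpha> \<noteq> {}" using \<alpha> by simp
  then have ne: "M \<noteq> {#}" using Mex by (metis UnI2 ex_in_conv set_mset_empty)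
  obtain p where p: "closed_walk G p" "mset p = M"
  proof (rule eulerian_closed_walk[OF M bal ne])
    fix S
    assume S: "\<And>a. a \<in># M \<Longrightarrow> initial G a \<in> S \<longleftrightarrow> terminal G a \<in> S"
      and ex: "\<exists>a. a \<in># M \<and> initial G a \<in> S"
    have "tail G e \<in> S \<longleftrightarrow> head G e \<in> S" if "e \<in> arcs T \<union> Poly_Mapping.keys \<alpha>" for e
      using Mex[OF that] S initial_in_iff_terminal_in by metis
    then show "\<forall>a. a \<in># M \<longrightarrow> initial G a \<in> S"
      using connecting_tree_arc_closed[OF T] ex Mfst by metis
  qed
  show thesis
  proof (rule that[OF p(1)])
    show "abelianization p = \<alpha>"
      by (rule poly_mapping_eqI) (use diff[of "(_, True)"] in \<open>simp add: lookup_abelianization p(2) count\<close>)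
    have "fst ` set p \<subseteq> arcs G"
      using p(1) by (auto simp: closed_walk_def walk_def oriented_edges_def)
    then have "walk_length \<mu> p = (\<Sum>e \<in> arcs G. (real (f (e, True)) + real (f (e, False))) * \<mu> e)"
      by (simp add: walk_length_count[of "arcs G"] p(2) count)
    also have "\<dots> = (\<Sum>e \<in> arcs G. 2 * (if e \<in> arcs T then \<mu> e else 0) + \<bar>real_of_int (?c e)\<bar> * \<mu> e)"
      by (intro sum.cong refl) (auto simp: f_def c0)
    also have "\<dots> = 2 * (\<Sum>e \<in> arcs G. if e \<in> arcs T then \<mu> e else 0) + chain_norm G \<mu> \<alpha>"
      by (simp add: sum.distrib sum_distrib_left chain_norm_def)
    also have "(\<Sum>e \<in> arcs G. if e \<in> arcs T then \<mu> e else 0) = (\<Sum>e \<in> arcs T. \<mu> e)"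
      using Tarcs by (simp add: sum.inter_restrict[symmetric] Int_absorb1 subset_eq)
    finally show "walk_length \<mu> p = 2 * (\<Sum>e \<in> arcs T. \<mu> e) + chain_norm G \<mu> \<alpha>" .
  qed
qed

text \<open>The image of \<open>p\<close> in the contraction is connected and passes through every
  contracted component; a spanning tree of this image is as required.\<close>

lemma connecting_tree_of_closed_walk:
  assumes G: "fin_digraph G" and p: "closed_walk G p"
  obtains T where "T \<in> connecting_trees G (chain_supp G (abelianization p))"
    "arcs T \<subseteq> fst ` set p - Poly_Mapping.keys (abelianization p)"
proof -
  interpret G: fin_digraph G by fact
  define H where "H = chain_supp G (abelianization p)"
  let ?\<pi> = "contraction_map H"
  have wfH: "wf_digraph H" by (simp add: H_def wf_digraph_chain_supp)
  define K where "K = \<lparr> verts = ?\<pi> ` initial G ` set p, arcs = fst ` set p - arcs H,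
    tail = ?\<pi> \<circ> tail G, head = ?\<pi> \<circ> head G \<rparr>"
  have pG: "fst a \<in> arcs G" if "a \<in> set p" for a
    using p that by (auto simp: closed_walk_def walk_def oriented_edges_iff)
  have pne: "p \<noteq> []" using p by (auto simp: closed_walk_def walk_def)
  \<comment> \<open>An edge with nonzero coefficient is traversed by \<open>p\<close>, so
    \<open>p\<close> visits every component of the support.\<close>
  have keys: "arcs H \<subseteq> fst ` set p"
  proof
    fix e assume "e \<in> arcs H"
    then have "Poly_Mapping.lookup (abelianization p) e \<noteq> 0" by (simp add: H_def in_keys_iff)
    then have "(e, True) \<in># mset p \<or> (e, False) \<in># mset p"
      unfolding lookup_abelianization by (metis count_eq_zero_iff diff_self of_nat_0)
    then show "e \<in> fst ` set p" by force
  qed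
  have ends: "tail G (fst a) \<in> initial G ` set p" "head G (fst a) \<in> initial G ` set p"
    if "a \<in> set p" for a
    using that initial_or_terminal[of _ G a] closed_walk_terminal_set[OF p] by blast+
  have vG: "initial G ` set p \<subseteq> verts G"
    using initial_in_verts[OF G.wf_digraph pG] by (rule image_subsetI)
  have wfK: "wf_digraph K" using ends by unfold_locales (auto simp: K_def)
  have sub: "subgraph K (contract G H)"
    using vG pG wfK wf_digraph_contract[OF G.wf_digraph]
    by (auto simp: subgraph_def compatible_def K_def)
  have "verts K \<subseteq> S" if S: "arc_closed K S" and v: "v \<in> verts K" "v \<in> S" for S v
  proof -
    \<comment> \<open>An edge of \<open>H\<close> lies in one fibre, and any other edge of
      \<open>p\<close> is an arc of \<open>K\<close>; hence \<open>p\<close> never crosses the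
      boundary of the preimage of \<open>S\<close>.\<close>
    have "initial G a \<in> ?\<pi> -` S \<longleftrightarrow> terminal G a \<in> ?\<pi> -` S" if a: "a \<in> set p" for a
    proof (cases "fst a \<in> arcs H")
      case True
      then show ?thesis
        using contraction_map_arc[OF wfH True]
        unfolding initial_in_iff_terminal_in by (simp add: H_def)
    next
      case False
      then have "fst a \<in> arcs K" using a by (simp add: K_def)
      then show ?thesis
        using arc_closedD[OF S] unfolding initial_in_iff_terminal_in by (simp add: K_def)
    qed
    then have "initial G a \<in> ?\<pi> -` S \<longleftrightarrow> initial G (hd p) \<in> ?\<pi> -` S" if "a \<in> set p" for a
      using walk_stays_in[of G p "?\<pi> -` S" a] p that by (simp add: closed_walk_def)
    then show ?thesis using v by (auto simp: K_def)
  qed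
  moreover have "verts K \<noteq> {}" using pne by (simp add: K_def)
  ultimately have "Digraph_Component.connected K"
    unfolding connected_iff_arc_closed[OF wfK] by blast
  then obtain T where T: "subgraph T K" "verts T = verts K" "undirected_tree T"
    using spanning_tree_exists[OF wfK] by (auto simp: K_def)
  have "verts C \<in> verts K" if C: "C \<in> components H" for C
  proof -
    obtain v where v: "v \<in> verts C" using components_connected(4)[OF C] by blast
    then have "v \<in> verts H" using components_connected(1)[OF C] by (auto simp: subgraph_def)
    then obtain e where e: "e \<in> arcs H" "v = tail G e \<or> v = head G e" by (auto simp: H_def)
    then obtain a where "a \<in> set p" "e = fst a" using keys by auto
    then have "v \<in> initial G ` set p" using ends e by blast
    then show ?thesis using contraction_map_component[OF C v] by (auto simp: K_def)
  qed
  then have "T \<in> connecting_trees G H"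
    using T subgraph_trans[OF T(1) sub] by (auto simp: connecting_trees_def)
  moreover have "arcs T \<subseteq> fst ` set p - arcs H" using T(1) by (auto simp: subgraph_def K_def)
  ultimately show thesis using that by (simp add: H_def)
qed

text \<open>The bound holds edge by edge. On \<open>U\<close> the coefficient is 0, so the edge is
  used equally often, hence at least once, in each direction; elsewhere the difference of the two
  counts is at most their sum in absolute value.\<close>

lemma walk_length_ge:
  assumes fin: "finite (arcs G)" and \<mu>: "graph_metric G \<mu>" and p: "walk G p"
    and U: "U \<subseteq> fst ` set p - Poly_Mapping.keys (abelianization p)"
  shows "2 * (\<Sum>e \<in> U. \<mu> e) + chain_norm G \<mu> (abelianization p) \<le> walk_length \<mu> p"
proof -
  let ?c = "Poly_Mapping.lookup (abelianization p)"
  let ?n = "\<lambda>e b. count (mset p) (e, b)"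
  have pG: "fst ` set p \<subseteq> arcs G" using p by (auto simp: walk_def oriented_edges_def)
  have UG: "U \<subseteq> arcs G" using U pG by blast
  have "2 * (if e \<in> U then \<mu> e else 0) + \<bar>real_of_int (?c e)\<bar> * \<mu> e
      \<le> (real (?n e True) + real (?n e False)) * \<mu> e" if e: "e \<in> arcs G" for e
  proof -
    have pos: "0 < \<mu> e" using \<mu> e by (simp add: graph_metric_def)
    show ?thesis
    proof (cases "e \<in> U")
      case True
      then have "?c e = 0" using U by (auto simp: in_keys_iff)
      then have eq: "?n e True = ?n e False" by (simp add: lookup_abelianization)
      obtain b where "(e, b) \<in># mset p" using True U by auto
      then have "0 < ?n e b" by simp
      then have "1 \<le> ?n e True" "1 \<le> ?n e False" using eq by (cases b; simp)+
      then have "2 \<le> real (?n e True) + real (?n e False)" by linarith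
      then have "2 * \<mu> e \<le> (real (?n e True) + real (?n e False)) * \<mu> e"
        using pos by (intro mult_right_mono) simp_all
      then show ?thesis using True \<open>?c e = 0\<close> by simp
    next
      case False
      have "\<bar>real_of_int (?c e)\<bar> \<le> real (?n e True) + real (?n e False)"
        by (simp add: lookup_abelianization)
      then show ?thesis using False pos by (simp add: mult_right_mono)
    qed
  qed
  then have "(\<Sum>e \<in> arcs G. 2 * (if e \<in> U then \<mu> e else 0) + \<bar>real_of_int (?c e)\<bar> * \<mu> e)
      \<le> walk_length \<mu> p"
    unfolding walk_length_count[OF fin pG] by (rule sum_mono)
  moreover have "(\<Sum>e \<in> arcs G. if e \<in> U then \<mu> e else 0) = (\<Sum>e \<in> U. \<mu> e)"
    using UG fin by (simp add: sum.inter_restrict[symmetric] Int_absorb1)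
  ultimately show ?thesis
    by (simp add: sum.distrib sum_distrib_left[symmetric] chain_norm_def)
qed

text \<open>A spanning tree of the whole contraction qualifies. Together with the finiteness of the
  set of weights this makes \<open>Min\<close> an attained minimum.\<close>

lemma connecting_trees_nonempty:
  assumes G: "fin_digraph G" "Digraph_Component.connected G" and H: "subgraph H G"
  shows "connecting_trees G H \<noteq> {}"
proof -
  interpret G: fin_digraph G by fact
  have wf: "wf_digraph (contract G H)" by (rule wf_digraph_contract) (rule G.wf_digraph)
  obtain T where T: "subgraph T (contract G H)" "verts T = verts (contract G H)" "undirected_tree T"
    using spanning_tree_exists[OF wf connected_contract[OF G.wf_digraph G(2) H]] by auto
  have "verts C \<in> contraction_map H ` verts G" if C: "C \<in> components H" for C
  proof -
    obtain v where v: "v \<in> verts C" using components_connected(4)[OF C] by blast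
    moreover have "v \<in> verts G" using v components_connected(1)[OF C] H by (auto simp: subgraph_def)
    ultimately show ?thesis using contraction_map_component[OF C v] by blast
  qed
  then have "T \<in> connecting_trees G H" using T by (auto simp: connecting_trees_def)
  then show ?thesis by blast
qed

lemma finite_connecting_tree_weights:
  assumes "finite (arcs G)"
  shows "finite ((\<lambda>T. \<Sum>e \<in> arcs T. \<mu> e) ` connecting_trees G H)"
proof (rule finite_subset)
  show "(\<lambda>T. \<Sum>e \<in> arcs T. \<mu> e) ` connecting_trees G H \<subseteq> sum \<mu> ` Pow (arcs G)"
    using connecting_treesD(3) by fastforce
qed (use assms in simp)

theorem theorem4p4:
  fixes G :: "('a, 'b) pre_digraph" and \<mu> :: "'b \<Rightarrow> real" and \<alpha> :: "'b \<Rightarrow>\<^sub>0 int"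
  assumes "finite_graph G"
    and "Digraph_Component.connected G"
    and "graph_metric G \<mu>"
    and "\<alpha> \<in> H1 G"
    and "\<alpha> \<noteq> 0"
  shows "circuits_of G \<alpha> \<noteq> {} \<and>
    (\<exists>p \<in> circuits_of G \<alpha>. walk_length \<mu> p = 2 * min_tree_weight G \<mu> \<alpha> + chain_norm G \<mu> \<alpha>) \<and>
    (\<forall>p \<in> circuits_of G \<alpha>. 2 * min_tree_weight G \<mu> \<alpha> + chain_norm G \<mu> \<alpha> \<le> walk_length \<mu> p)"
proof -
  have G: "fin_digraph G" using assms(1) by (simp add: finite_graph_def)
  then interpret G: fin_digraph G .
  let ?H = "chain_supp G \<alpha>" and ?w = "\<lambda>T. \<Sum>e \<in> arcs T. \<mu> e"
  let ?L = "2 * min_tree_weight G \<mu> \<alpha> + chain_norm G \<mu> \<alpha>"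
  have "subgraph ?H G"
    using assms(4) by (intro subgraph_chain_supp G.wf_digraph) (simp add: H1_def)
  then have ne: "?w ` connecting_trees G ?H \<noteq> {}"
    using connecting_trees_nonempty[OF G assms(2)] by blast
  have fin: "finite (?w ` connecting_trees G ?H)" by (simp add: finite_connecting_tree_weights)
  have lower: "?L \<le> walk_length \<mu> p" if p: "p \<in> circuits_of G \<alpha>" for p
  proof -
    have cw: "closed_walk G p" and ab: "abelianization p = \<alpha>"
      using p by (auto simp: circuits_of_def circuit_def)
    obtain T where T: "T \<in> connecting_trees G ?H" "arcs T \<subseteq> fst ` set p - Poly_Mapping.keys \<alpha>"
      using connecting_tree_of_closed_walk[OF G cw] ab by blast
    have "min_tree_weight G \<mu> \<alpha> \<le> ?w T"
      unfolding min_tree_weight_def using fin T(1) by (intro Min_le) simp_all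
    moreover have "2 * ?w T + chain_norm G \<mu> \<alpha> \<le> walk_length \<mu> p"
      using walk_length_ge[OF _ assms(3), of p "arcs T"] T(2) cw by (simp add: ab closed_walk_def)
    ultimately show ?thesis by linarith
  qed
  obtain T where T: "T \<in> connecting_trees G ?H" "min_tree_weight G \<mu> \<alpha> = ?w T"
    using Min_in[OF fin ne] by (auto simp: min_tree_weight_def)
  obtain p where p: "closed_walk G p" "abelianization p = \<alpha>"
    "walk_length \<mu> p = 2 * ?w T + chain_norm G \<mu> \<alpha>"
    using closed_walk_of_connecting_tree[OF G assms(4,5) T(1), of \<mu>] by blast
  obtain q where q: "circuit G q" "abelianization q = \<alpha>" "walk_length \<mu> q \<le> walk_length \<mu> p"
    using circuit_of_closed_walk[OF p(1), of \<mu>] p(2) assms(3,5) by (auto simp: graph_metric_def)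
  have qc: "q \<in> circuits_of G \<alpha>" using q by (simp add: circuits_of_def)
  then have "walk_length \<mu> q = ?L" using lower[OF qc] q(3) p(3) T(2) by linarith
  then show ?thesis using qc lower by blast
qed

end
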